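(* Given the reduced form of a structural VARMA model satisfying the standing assumptions in the context, the transmission effects of the shock $\varepsilon_i$ can be obtained if the $i$th column $\Phi_{\cdot,i}$ of the structural impulse response matrix is known (no other column of $\Phi$ being needed). Precisely: let $i\in\{1,\dots,K\}$, and let two structural VARMA models satisfying the standing assumptions, with the same $K$, horizon $h$ and transmission matrix $T$, have the same reduced form and the same $i$th column $\Phi_{\cdot,i}$ of the structural impulse response matrix. Then for every $j\in\{1,\dots,(h+1)K\}$ the set $\mathcal{P}_{\varepsilon_i,x_j}$ of paths from $\varepsilon_i$ to $x_j$ is the same in the graphs induced by the two models, and for every $P_{\varepsilon_i,x_j}\subseteq\mathcal{P}_{\varepsilon_i,x_j}$ and every $\xi\in\mathbb{R}$ the effect $\mathcal{Q}_\xi(P_{\varepsilon_i,x_j})$ is the same in the two models.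
   Context: Model. Let $K\ge1$, $\ell,q,h\ge0$ be integers. $y_t$ is a $K$-dimensional stationary process satisfying the structural VARMA equation $A_0y_t=\sum_{i=1}^{\ell}A_iy_{t-i}+\sum_{j=1}^{q}\Psi_j\varepsilon_{t-j}+\varepsilon_t$ with real $K\times K$ matrices. Standing assumptions: $E[\varepsilon_t]=0$, $E[\varepsilon_t\varepsilon_t']=I$, $E[\varepsilon_t\varepsilon_{t-r}']=O$ for all $r\ge1$; $A_0$ is non-singular. $T$ is a fixed $K\times K$ permutation matrix (the transmission matrix). Put $y_t^*=Ty_t$, $A_i^*=A_iT'$ for $i\ge0$, with $A_i^*=O$ for $i>\ell$ and $\Psi_j=O$ for $j>q$. Let $A_0^*=QL$ be the unique QL-decomposition with $Q$ orthogonal and $L$ lower-triangular with positive diagonal, and let $D=\mathrm{diag}(L)^{-1}$ be the inverse of the diagonal part of $L$. Reduced form. With $u_t=A_0^{-1}\varepsilon_t$ the model reads $y_t=\sum_{i=1}^{\ell}A_0^{-1}A_iy_{t-i}+u_t+\sum_{j=1}^{q}A_0^{-1}\Psi_jA_0u_{t-j}$ with $E[u_tu_t']=A_0^{-1}(A_0^{-1})'$. Two models have the same reduced form if they have the same matrices $A_0^{-1}A_i$ ($i\ge1$), $A_0^{-1}\Psi_jA_0$ ($j\ge1$) and $A_0^{-1}(A_0^{-1})'$. Systems form. Let $N=(h+1)K$, $x=(y_t^{*\prime},\dots,y_{t+h}^{*\prime})'$, $\varepsilon=(\varepsilon_t',\dots,\varepsilon_{t+h}')'$. $B$ and $\Omega$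 are $N\times N$ matrices made of $K\times K$ blocks indexed by $a,b\in\{0,\dots,h\}$: for $a=b$ the block of $B$ is $I-DL$ and that of $\Omega$ is $DQ'$; for $a>b$ the block of $B$ is $DQ'A^*_{a-b}$ and that of $\Omega$ is $DQ'\Psi_{a-b}$; for $a<b$ both are zero. So $B$ is strictly lower-triangular. The system is $x=Bx+\Omega\varepsilon$ (variables and shocks dated before $t$, being unaffected by shocks at $t$, are dropped). $\Phi=(I-B)^{-1}\Omega$ is the structural impulse response matrix. Graph. $\mathcal{G}(B,\Omega)$ is the directed acyclic graph with nodes $\varepsilon_1,\dots,\varepsilon_K$ (the shocks at time $t$) and $x_1,\dots,x_N$. There is an edge $x_m\to x_n$ iff $B_{n,m}\ne0$, with path coefficient $\omega_{x_m,x_n}=B_{n,m}$, and an edge $\varepsilon_i\to x_n$ iff $\Omega_{n,i}\neq0$, with path coefficient $\omega_{\varepsilon_i,x_n}=\Omega_{n,i}$. $\mathcal{P}_{u,v}$ is the set of all directed paths from node $u$ to node $v$. A transmission channel is a subset $P_{\varepsilon_i,x_j}\subset\mathcal{P}_{\varepsilon_i,x_j}$; for shock size $\xi$ its transmission effect is $\mathcal{Q}_\xi(P_{\varepsilon_i,x_j})=\sum_{p\in P_{\varepsilon_i,x_j}}\xi\prod_{(u\to v)\in p}\omega_{u,v}$. *)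

theory Defs
  imports
    "HOL-Probability.Probability_Measure"
    "Jordan_Normal_Form.Gauss_Jordan_Elimination"
    "Graph_Theory.Pair_Digraph"
begin

no_notation vec_nth (infixl "$" 90)

(* All coordinates are 0-based: the i-th shock at time t (i = 1..K in the usual numbering) is
   index i - 1 < K, and the j-th entry of the stacked vector x is index j - 1 < (h+1) K. *)

definition minv :: "real mat \<Rightarrow> real mat" where
  "minv X = the (mat_inverse X)"

definition permutation_matrix :: "nat \<Rightarrow> real mat \<Rightarrow> bool" where
  "permutation_matrix K T \<longleftrightarrow>
     (\<exists>p. p permutes {..<K} \<and> T = Matrix.mat K K (\<lambda>(i, j). if p i = j then 1 else 0))"

(* Random vectors are functions into K-dimensional vectors; expectations of vectors and matrices
   are taken entry by entry. Stationarity means covariance stationarity. *)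

definition covariance_stationary ::
    "'w measure \<Rightarrow> nat \<Rightarrow> (int \<Rightarrow> 'w \<Rightarrow> real Matrix.vec) \<Rightarrow> bool" where
  "covariance_stationary M K y \<longleftrightarrow>
     (\<forall>t. \<forall>a<K. integrable M (\<lambda>\<omega>. (y t \<omega> $ a)\<^sup>2)) \<and>
     (\<forall>s t. \<forall>a<K. (\<integral>\<omega>. y s \<omega> $ a \<partial>M) = (\<integral>\<omega>. y t \<omega> $ a \<partial>M)) \<and>
     (\<forall>s t r. \<forall>a<K. \<forall>b<K.
        (\<integral>\<omega>. (y (s + r) \<omega> $ a) * (y s \<omega> $ b) \<partial>M) =
        (\<integral>\<omega>. (y (t + r) \<omega> $ a) * (y t \<omega> $ b) \<partial>M))"

(* A and \<Psi> are sequences of coefficient matrices, extended by zero beyond the lag orders;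
   \<Psi> 0 is not part of the model. *)

locale structural_VARMA = prob_space M
  for M :: "'w measure" +
  fixes K l q :: nat
    and A \<Psi> :: "nat \<Rightarrow> real mat"
    and y \<epsilon> :: "int \<Rightarrow> 'w \<Rightarrow> real Matrix.vec"
  assumes K_pos: "K \<ge> 1"
    and A_carrier: "\<And>i. A i \<in> carrier_mat K K"
    and \<Psi>_carrier: "\<And>j. j \<ge> 1 \<Longrightarrow> \<Psi> j \<in> carrier_mat K K"
    and A_zero: "\<And>i. i > l \<Longrightarrow> i \<ge> 1 \<Longrightarrow> A i = 0\<^sub>m K K"
    and \<Psi>_zero: "\<And>j. j > q \<Longrightarrow> j \<ge> 1 \<Longrightarrow> \<Psi> j = 0\<^sub>m K K"
    and A0_nonsingular: "invertible_mat (A 0)"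
    and y_carrier: "\<And>t \<omega>. \<omega> \<in> space M \<Longrightarrow> y t \<omega> \<in> carrier_vec K"
    and \<epsilon>_carrier: "\<And>t \<omega>. \<omega> \<in> space M \<Longrightarrow> \<epsilon> t \<omega> \<in> carrier_vec K"
    and y_measurable: "\<And>t a. a < K \<Longrightarrow> random_variable borel (\<lambda>\<omega>. y t \<omega> $ a)"
    and \<epsilon>_measurable: "\<And>t a. a < K \<Longrightarrow> random_variable borel (\<lambda>\<omega>. \<epsilon> t \<omega> $ a)"
    and y_stationary: "covariance_stationary M K y"
    and \<epsilon>_square_integrable: "\<And>t a. a < K \<Longrightarrow> integrable M (\<lambda>\<omega>. (\<epsilon> t \<omega> $ a)\<^sup>2)"
    and \<epsilon>_mean: "\<And>t a. a < K \<Longrightarrow> expectation (\<lambda>\<omega>. \<epsilon> t \<omega> $ a) = 0"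
    and \<epsilon>_covariance: "\<And>t a b. a < K \<Longrightarrow> b < K \<Longrightarrow>
          expectation (\<lambda>\<omega>. (\<epsilon> t \<omega> $ a) * (\<epsilon> t \<omega> $ b)) = 1\<^sub>m K $$ (a, b)"
    and \<epsilon>_uncorrelated: "\<And>t r a b. r \<ge> (1::nat) \<Longrightarrow> a < K \<Longrightarrow> b < K \<Longrightarrow>
          expectation (\<lambda>\<omega>. (\<epsilon> t \<omega> $ a) * (\<epsilon> (t - int r) \<omega> $ b)) = 0"
    and VARMA_equation: "\<And>t. AE \<omega> in M. \<forall>a<K.
          (A 0 *\<^sub>v y t \<omega>) $ a =
            (\<Sum>i=1..l. (A i *\<^sub>v y (t - int i) \<omega>) $ a) +
            (\<Sum>j=1..q. (\<Psi> j *\<^sub>v \<epsilon> (t - int j) \<omega>) $ a) + \<epsilon> t \<omega> $ a"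

definition same_reduced_form ::
    "(nat \<Rightarrow> real mat) \<Rightarrow> (nat \<Rightarrow> real mat) \<Rightarrow> (nat \<Rightarrow> real mat) \<Rightarrow> (nat \<Rightarrow> real mat) \<Rightarrow> bool" where
  "same_reduced_form A \<Psi> A' \<Psi>' \<longleftrightarrow>
     (\<forall>i\<ge>1. minv (A 0) * A i = minv (A' 0) * A' i) \<and>
     (\<forall>j\<ge>1. minv (A 0) * \<Psi> j * A 0 = minv (A' 0) * \<Psi>' j * A' 0) \<and>
     minv (A 0) * transpose_mat (minv (A 0)) = minv (A' 0) * transpose_mat (minv (A' 0))"

definition is_QL :: "nat \<Rightarrow> real mat \<Rightarrow> real mat \<times> real mat \<Rightarrow> bool" where
  "is_QL K X = (\<lambda>(Q, L).
     Q \<in> carrier_mat K K \<and> L \<in> carrier_mat K K \<and>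
     transpose_mat Q * Q = 1\<^sub>m K \<and> Q * transpose_mat Q = 1\<^sub>m K \<and>
     (\<forall>a<K. \<forall>b<K. a < b \<longrightarrow> L $$ (a, b) = 0) \<and> (\<forall>a<K. L $$ (a, a) > 0) \<and>
     X = Q * L)"

definition A_star :: "real mat \<Rightarrow> (nat \<Rightarrow> real mat) \<Rightarrow> nat \<Rightarrow> real mat" where
  "A_star T A i = A i * transpose_mat T"

(* For a non-singular argument the decomposition exists and is unique. *)
definition Q_mat :: "nat \<Rightarrow> real mat \<Rightarrow> (nat \<Rightarrow> real mat) \<Rightarrow> real mat" where
  "Q_mat K T A = fst (THE d. is_QL K (A_star T A 0) d)"

definition L_mat :: "nat \<Rightarrow> real mat \<Rightarrow> (nat \<Rightarrow> real mat) \<Rightarrow> real mat" where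
  "L_mat K T A = snd (THE d. is_QL K (A_star T A 0) d)"

definition D_mat :: "nat \<Rightarrow> real mat \<Rightarrow> (nat \<Rightarrow> real mat) \<Rightarrow> real mat" where
  "D_mat K T A = minv (mat_diag K (\<lambda>k. L_mat K T A $$ (k, k)))"

definition B_block :: "nat \<Rightarrow> real mat \<Rightarrow> (nat \<Rightarrow> real mat) \<Rightarrow> nat \<Rightarrow> nat \<Rightarrow> real mat" where
  "B_block K T A a b =
     (if a = b then 1\<^sub>m K - D_mat K T A * L_mat K T A
      else if a > b then D_mat K T A * transpose_mat (Q_mat K T A) * A_star T A (a - b)
      else 0\<^sub>m K K)"

definition \<Omega>_block ::
    "nat \<Rightarrow> real mat \<Rightarrow> (nat \<Rightarrow> real mat) \<Rightarrow> (nat \<Rightarrow> real mat) \<Rightarrow> nat \<Rightarrow> nat \<Rightarrow> real mat" where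
  "\<Omega>_block K T A \<Psi> a b =
     (if a = b then D_mat K T A * transpose_mat (Q_mat K T A)
      else if a > b then D_mat K T A * transpose_mat (Q_mat K T A) * \<Psi> (a - b)
      else 0\<^sub>m K K)"

(* The h+1 by h+1 array of K by K blocks X a b as one matrix. *)
definition block_matrix :: "nat \<Rightarrow> nat \<Rightarrow> (nat \<Rightarrow> nat \<Rightarrow> real mat) \<Rightarrow> real mat" where
  "block_matrix K h X = Matrix.mat ((h + 1) * K) ((h + 1) * K)
     (\<lambda>(r, c). X (r div K) (c div K) $$ (r mod K, c mod K))"

definition B_mat :: "nat \<Rightarrow> nat \<Rightarrow> real mat \<Rightarrow> (nat \<Rightarrow> real mat) \<Rightarrow> real mat" where
  "B_mat K h T A = block_matrix K h (B_block K T A)"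

definition \<Omega>_mat ::
    "nat \<Rightarrow> nat \<Rightarrow> real mat \<Rightarrow> (nat \<Rightarrow> real mat) \<Rightarrow> (nat \<Rightarrow> real mat) \<Rightarrow> real mat" where
  "\<Omega>_mat K h T A \<Psi> = block_matrix K h (\<Omega>_block K T A \<Psi>)"

definition \<Phi>_mat ::
    "nat \<Rightarrow> nat \<Rightarrow> real mat \<Rightarrow> (nat \<Rightarrow> real mat) \<Rightarrow> (nat \<Rightarrow> real mat) \<Rightarrow> real mat" where
  "\<Phi>_mat K h T A \<Psi> = minv (1\<^sub>m ((h + 1) * K) - B_mat K h T A) * \<Omega>_mat K h T A \<Psi>"

datatype node = Shock nat | Var nat

(* Only the K shocks dated t are nodes; the columns of \<Omega> belonging to later shocks do not
   enter the graph. *)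
definition system_graph :: "nat \<Rightarrow> nat \<Rightarrow> real mat \<Rightarrow> real mat \<Rightarrow> node pair_pre_digraph" where
  "system_graph K h B \<Omega> = \<lparr>
     pverts = Shock ` {..<K} \<union> Var ` {..<(h + 1) * K},
     parcs = {(Var m, Var n) | m n. m < (h + 1) * K \<and> n < (h + 1) * K \<and> B $$ (n, m) \<noteq> 0} \<union>
             {(Shock i, Var n) | i n. i < K \<and> n < (h + 1) * K \<and> \<Omega> $$ (n, i) \<noteq> 0} \<rparr>"

fun path_coeff :: "real mat \<Rightarrow> real mat \<Rightarrow> node \<times> node \<Rightarrow> real" where
  "path_coeff B \<Omega> (Var m, Var n) = B $$ (n, m)"
| "path_coeff B \<Omega> (Shock i, Var n) = \<Omega> $$ (n, i)"
| "path_coeff B \<Omega> (_, Shock _) = 0"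

(* A path is represented by the list of its arcs. *)
definition paths :: "nat \<Rightarrow> nat \<Rightarrow> real mat \<Rightarrow> real mat \<Rightarrow> node \<Rightarrow> node \<Rightarrow> (node \<times> node) list set" where
  "paths K h B \<Omega> u v = {p. pre_digraph.apath (with_proj (system_graph K h B \<Omega>)) u p v}"

definition transmission_effect ::
    "real mat \<Rightarrow> real mat \<Rightarrow> real \<Rightarrow> (node \<times> node) list set \<Rightarrow> real" where
  "transmission_effect B \<Omega> \<xi> P = (\<Sum>p\<in>P. \<xi> * (\<Prod>e\<leftarrow>p. path_coeff B \<Omega> e))"

end

theory Submission
  imports Defs "Jordan_Normal_Form.Determinant"
begin

text \<open>
  Equality of the two innovation covariances means that the contemporaneous matrices differ by an
  orthogonal factor, \<open>A\<^sub>2 0 = R * A\<^sub>1 0\<close>; the reduced-form lag coefficients then give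
  \<open>A\<^sub>2 k = R * A\<^sub>1 k\<close> for all \<open>k\<close>. By uniqueness of the QL decomposition, \<open>R\<close> is absorbed in the
  orthogonal factor \<open>Q\<close> and cancels in \<open>Q\<^sup>T * A k\<close>, so both models have the same matrix \<open>B\<close>. Since
  \<open>1 - B\<close> is unit lower triangular, the \<open>i\<close>th column of \<open>\<Omega> = (1 - B) * \<Phi>\<close> is determined by that of
  \<open>\<Phi>\<close>. Shocks have no incoming arcs, so the paths out of the \<open>i\<close>th shock involve no other
  column of \<open>\<Omega>\<close>.
\<close>

section \<open>Inverses\<close>

text \<open>\<open>minv\<close> applies \<open>the\<close> to an option, so its value is controlled
  only once the argument is known to be a unit. For square matrices a right inverse is also a left
  inverse, which excludes \<open>None\<close>; uniqueness of inverses then fixes the value.\<close>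

lemma minv_eqI:
  assumes X: "X \<in> carrier_mat n n" and Y: "Y \<in> carrier_mat n n" and XY: "X * Y = 1\<^sub>m n"
  shows "minv X = Y"
proof -
  have YX: "Y * X = 1\<^sub>m n"
    by (rule mat_mult_left_right_inverse[OF X Y XY])
  have "X \<in> Units (ring_mat TYPE(real) n ())"
    using X Y XY YX unfolding Units_def ring_mat_def by auto
  then obtain Z where Z: "mat_inverse X = Some Z"
    using mat_inverse(1)[OF X, where b = "()"] by (cases "mat_inverse X") auto
  then have ZX: "Z * X = 1\<^sub>m n" and Zc: "Z \<in> carrier_mat n n"
    using mat_inverse(2)[OF X] by auto
  have "Z = Z * (X * Y)" using XY Zc by simp
  also have "\<dots> = (Z * X) * Y" using assoc_mult_mat[OF Zc X Y] by simp
  also have "\<dots> = Y" using ZX Y by simp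
  finally show ?thesis using Z by (simp add: minv_def)
qed

text \<open>\<open>invertible_mat\<close> does not fix the dimensions of the inverse; they are read
  off from the two products.\<close>

lemma invertible_mat_inverse:
  assumes X: "X \<in> carrier_mat n n" and inv: "invertible_mat X"
  obtains Y where "Y \<in> carrier_mat n n" "X * Y = 1\<^sub>m n" "Y * X = 1\<^sub>m n"
proof -
  obtain Y where XY: "X * Y = 1\<^sub>m n" and YX: "Y * X = 1\<^sub>m (dim_row Y)"
    using X inv unfolding invertible_mat_def inverts_mat_def by auto
  have "dim_col Y = n" using XY by (metis index_mult_mat(3) index_one_mat(3))
  moreover have "dim_row Y = n" using YX X by (metis carrier_matD(2) index_mult_mat(3) index_one_mat(3))
  ultimately show ?thesis using that XY YX by auto
qed

section \<open>The QL decomposition\<close>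

text \<open>Induction on the size through the Schur complement of the last diagonal entry. The
  elimination starts at the last index because the factorization is \<open>S\<close> = L^T L with L
  lower triangular, rather than the usual L L^T. Working with functions on indices avoids reshaping
  matrices in the induction.\<close>

lemma cholesky_exists:
  fixes S :: "nat \<Rightarrow> nat \<Rightarrow> real"
  assumes "\<And>i j. i < n \<Longrightarrow> j < n \<Longrightarrow> S i j = S j i"
    and "\<And>x. \<exists>i<n. x i \<noteq> 0 \<Longrightarrow> 0 < (\<Sum>i<n. \<Sum>j<n. x i * S i j * x j)"
  shows "\<exists>L. (\<forall>i j. i < j \<longrightarrow> j < n \<longrightarrow> L i j = 0) \<and> (\<forall>i<n. 0 < L i i) \<and>
    (\<forall>i<n. \<forall>j<n. S i j = (\<Sum>k<n. L k i * L k j :: real))"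
  using assms
proof (induction n arbitrary: S)
  case 0
  then show ?case by auto
next
  case (Suc n)
  define a where "a = S n n"
  define S' where "S' = (\<lambda>i j. S i j - S n i * S n j / a)"
  \<comment> \<open>Testing the form on the last unit vector gives positivity of the pivot
    \<open>a\<close>.\<close>
  have "0 < (\<Sum>i<Suc n. \<Sum>j<Suc n. (if i = n then 1 else 0) * S i j * (if j = n then 1 else 0))"
    by (rule Suc.prems(2)) auto
  then have a: "a > 0" by (simp add: a_def)
  have "\<exists>L. (\<forall>i j. i < j \<longrightarrow> j < n \<longrightarrow> L i j = 0) \<and> (\<forall>i<n. 0 < L i i) \<and>
    (\<forall>i<n. \<forall>j<n. S' i j = (\<Sum>k<n. L k i * L k j :: real))"
  proof (rule Suc.IH)
    show "S' i j = S' j i" if "i < n" "j < n" for i j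
      using Suc.prems(1)[of i j] that by (simp add: S'_def)
  next
    fix x :: "nat \<Rightarrow> real"
    assume x: "\<exists>i<n. x i \<noteq> 0"
    define s where "s = (\<Sum>j<n. S n j * x j)"
    \<comment> \<open>The last coordinate is the minimizer of the form of \<open>S\<close> over all
      extensions of \<open>x\<close>. At this extension the form equals
      \<open>q - s * s / a\<close>, which is the form of the Schur complement \<open>S'\<close> at
      \<open>x\<close>.\<close>
    define x' where "x' = (\<lambda>i. if i = n then - s / a else x i)"
    define q where "q = (\<Sum>i<n. \<Sum>j<n. x i * S i j * x j)"
    have "0 < (\<Sum>i<Suc n. \<Sum>j<Suc n. x' i * S i j * x' j)"
      using x by (intro Suc.prems(2)) (auto simp: x'_def)
    also have "\<dots> = q + (\<Sum>i<n. x i * S i n * (- s / a)) + (\<Sum>j<n. (- s / a) * S n j * x j)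
        + (- s / a) * a * (- s / a)"
      by (simp add: x'_def q_def sum.distrib a_def sum_subtractf sum_negf)
    also have "(\<Sum>i<n. x i * S i n * (- s / a)) = s * (- s / a)"
      unfolding s_def sum_distrib_right
      by (rule sum.cong) (auto simp: Suc.prems(1)[of _ n] s_def)
    also have "(\<Sum>j<n. (- s / a) * S n j * x j) = (- s / a) * s"
      unfolding s_def sum_distrib_left by (rule sum.cong) auto
    also have "q + s * (- s / a) + (- s / a) * s + (- s / a) * a * (- s / a) = q - s * s / a"
      using a by (simp add: field_simps)
    also have "s * s = (\<Sum>i<n. \<Sum>j<n. x i * (S n i * S n j) * x j)"
      by (simp add: s_def sum_product mult_ac)
    also have "q - (\<Sum>i<n. \<Sum>j<n. x i * (S n i * S n j) * x j) / a
        = (\<Sum>i<n. \<Sum>j<n. x i * S' i j * x j)"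
      by (simp add: q_def S'_def sum_divide_distrib algebra_simps sum_subtractf)
    finally show "0 < (\<Sum>i<n. \<Sum>j<n. x i * S' i j * x j)" .
  qed
  then obtain L where L: "\<forall>i j. i < j \<longrightarrow> j < n \<longrightarrow> L i j = 0" "\<forall>i<n. 0 < L i i"
    "\<forall>i<n. \<forall>j<n. S' i j = (\<Sum>k<n. L k i * L k j)" by blast
  \<comment> \<open>The new last row supplies the rank-one term that was subtracted in
    \<open>S'\<close>; its diagonal entry is \<open>S n n / sqrt a\<close>, that is, sqrt a. The
    rows above it are extended by zero in the last column.\<close>
  define L' where "L' = (\<lambda>k i. if k = n then S n i / sqrt a else if i < n then L k i else 0)"
  have "S i j = (\<Sum>k<Suc n. L' k i * L' k j)" if "i < Suc n" "j < Suc n" for i j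
  proof -
    have "(\<Sum>k<Suc n. L' k i * L' k j) = (\<Sum>k<n. L' k i * L' k j) + S n i * S n j / a"
      using a by (simp add: L'_def)
    also have "(\<Sum>k<n. L' k i * L' k j) = (if i < n \<and> j < n then S' i j else 0)"
      using L(3) by (auto simp: L'_def intro!: sum.cong)
    also have "\<dots> + S n i * S n j / a = S i j"
      using a that Suc.prems(1)[of i n] by (auto simp: S'_def a_def less_Suc_eq)
    finally show ?thesis by simp
  qed
  moreover have "\<forall>i j. i < j \<longrightarrow> j < Suc n \<longrightarrow> L' i j = 0"
    using L(1) by (auto simp: L'_def)
  moreover have "\<forall>i<Suc n. 0 < L' i i"
    using L(2) a by (auto simp: L'_def a_def)
  ultimately show ?case by blast
qed

text \<open>In the last column of the Gram identity only the last rows contribute, by triangularity.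
  Positivity then determines first the corner entry and next the whole last row; subtracting that
  row's contribution leaves the same problem of size one less.\<close>

lemma cholesky_unique:
  fixes L M :: "nat \<Rightarrow> nat \<Rightarrow> real"
  assumes "\<And>i j. i < j \<Longrightarrow> j < n \<Longrightarrow> L i j = 0" "\<And>i. i < n \<Longrightarrow> 0 < L i i"
    and "\<And>i j. i < j \<Longrightarrow> j < n \<Longrightarrow> M i j = 0" "\<And>i. i < n \<Longrightarrow> 0 < M i i"
    and "\<And>i j. i < n \<Longrightarrow> j < n \<Longrightarrow> (\<Sum>k<n. L k i * L k j) = (\<Sum>k<n. M k i * M k j)"
    and "i < n" "j < n"
  shows "L i j = M i j"
  using assms
proof (induction n arbitrary: i j)
  case 0
  then show ?case by simp
next
  case (Suc n)
  have last: "L n i * L n n = M n i * M n n" if "i < Suc n" for i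
    using Suc.prems(5)[OF that, of n] Suc.prems(1)[of _ n] Suc.prems(3)[of _ n] by simp
  have pos: "0 < L n n" "0 < M n n" using Suc.prems(2,4)[of n] by auto
  have "(L n n)\<^sup>2 = (M n n)\<^sup>2" using last[of n] by (simp add: power2_eq_square)
  then have "L n n = M n n" using pos by (simp add: power2_eq_iff_nonneg)
  then have row: "L n i = M n i" if "i < Suc n" for i using last[OF that] pos by simp
  have "L i j = M i j" if "i < n" "j < n" for i j
  proof (rule Suc.IH)
    show "(\<Sum>k<n. L k i * L k j) = (\<Sum>k<n. M k i * M k j)" if "i < n" "j < n" for i j
      using Suc.prems(5)[of i j] row[of i] row[of j] that by simp
  qed (use Suc.prems(1-4) that in auto)
  moreover have "L i n = M i n" if "i < n" for i using Suc.prems(1,3)[of i n] that by simp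
  ultimately show ?case using row Suc.prems(6,7) by (auto simp: less_Suc_eq)
qed

section \<open>Gram matrices and the passage from Cholesky factors to the QL decomposition\<close>

lemma transpose_mult_self_index:
  assumes "X \<in> carrier_mat n n" "i < n" "j < n"
  shows "(transpose_mat X * X) $$ (i, j) = (\<Sum>k<n. X $$ (k, i) * X $$ (k, j) :: real)"
  using assms by (auto simp: scalar_prod_def atLeast0LessThan intro!: sum.cong)

text \<open>The quadratic form is the sum of squares of the entries of X v, and X v = 0 forces v = 0
  by the left inverse \<open>Y\<close>.\<close>

lemma gram_matrix_pos_def:
  fixes X :: "real mat" and x :: "nat \<Rightarrow> real"
  assumes X: "X \<in> carrier_mat n n" and Y: "Y \<in> carrier_mat n n" and YX: "Y * X = 1\<^sub>m n"
    and x: "\<exists>i<n. x i \<noteq> 0"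
  shows "0 < (\<Sum>i<n. \<Sum>j<n. x i * (transpose_mat X * X) $$ (i, j) * x j)"
proof -
  define z where "z = (\<lambda>k. \<Sum>i<n. X $$ (k, i) * x i)"
  define v where "v = Matrix.vec n x"
  have v: "v \<in> carrier_vec n" by (simp add: v_def)
  have Xv: "X *\<^sub>v v = Matrix.vec n z"
    using X by (auto simp: v_def z_def scalar_prod_def atLeast0LessThan intro!: eq_vecI sum.cong)
  have "\<exists>k<n. z k \<noteq> 0"
  proof (rule ccontr)
    assume "\<not> ?thesis"
    then have "X *\<^sub>v v = 0\<^sub>v n" unfolding Xv by auto
    then have "Y *\<^sub>v (X *\<^sub>v v) = 0\<^sub>v n" using Y by auto
    then have "v = 0\<^sub>v n" using assoc_mult_mat_vec[OF Y X v] YX v by simp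
    then show False using x by (metis index_vec index_zero_vec(1) v_def)
  qed
  then obtain k where "k < n" "z k \<noteq> 0" by blast
  then have "0 < (\<Sum>k<n. z k * z k)"
    by (intro sum_pos2[of _ k]) (auto simp: zero_less_mult_iff)
  also have "\<dots> = (\<Sum>k<n. \<Sum>i<n. \<Sum>j<n. x i * (X $$ (k, i) * X $$ (k, j)) * x j)"
    by (simp add: z_def sum_product mult_ac)
  also have "\<dots> = (\<Sum>i<n. \<Sum>k<n. \<Sum>j<n. x i * (X $$ (k, i) * X $$ (k, j)) * x j)"
    by (rule sum.swap)
  also have "\<dots> = (\<Sum>i<n. \<Sum>j<n. \<Sum>k<n. x i * (X $$ (k, i) * X $$ (k, j)) * x j)"
    by (intro sum.cong refl sum.swap)
  also have "\<dots> = (\<Sum>i<n. \<Sum>j<n. x i * (transpose_mat X * X) $$ (i, j) * x j)"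
    using X by (intro sum.cong refl)
      (simp add: transpose_mult_self_index sum_distrib_left sum_distrib_right del: index_mult_mat)
  finally show ?thesis .
qed

text \<open>Take L from the Cholesky factorization of X^T X and put Q = X L^{-1}; then Q^T Q =
  L^{-T} (X^T X) L^{-1} is the identity.\<close>

lemma is_QL_exists:
  assumes X: "X \<in> carrier_mat n n" and Y: "Y \<in> carrier_mat n n" and XY: "X * Y = 1\<^sub>m n"
  shows "\<exists>d. is_QL n X d"
proof -
  note assoc = assoc_mult_mat[of _ n n _ n _ n]
  have YX: "Y * X = 1\<^sub>m n" by (rule mat_mult_left_right_inverse[OF X Y XY])
  let ?S = "transpose_mat X * X"
  have sym: "?S $$ (i, j) = ?S $$ (j, i)" if "i < n" "j < n" for i j
    using X that by (simp add: transpose_mult_self_index mult.commute del: index_mult_mat)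
  obtain L where L: "\<forall>i j. i < j \<longrightarrow> j < n \<longrightarrow> L i j = 0" "\<forall>i<n. 0 < L i i"
      "\<forall>i<n. \<forall>j<n. ?S $$ (i, j) = (\<Sum>k<n. L k i * L k j :: real)"
    using cholesky_exists[of n "\<lambda>i j. ?S $$ (i, j)", OF sym gram_matrix_pos_def[OF X Y YX]] by blast
  define LL where "LL = Matrix.mat n n (\<lambda>(i, j). L i j)"
  have LL: "LL \<in> carrier_mat n n" by (simp add: LL_def)
  have gram: "transpose_mat LL * LL = ?S"
  proof (rule eq_matI)
    fix i j assume "i < dim_row ?S" "j < dim_col ?S"
    then have ij: "i < n" "j < n" using X by auto
    have "(transpose_mat LL * LL) $$ (i, j) = (\<Sum>k<n. L k i * L k j)"
      using ij by (simp only: transpose_mult_self_index[OF LL]) (simp add: LL_def)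
    then show "(transpose_mat LL * LL) $$ (i, j) = ?S $$ (i, j)" using L(3) ij by simp
  qed (use X LL in auto)
  \<comment> \<open>Since \<open>Y * transpose_mat Y\<close> inverts X^T X = L^T L, this
    \<open>W\<close> is the inverse of L^T, and its transpose is the inverse of L. No separate
    inversion of a triangular matrix is required.\<close>
  define W where "W = LL * (Y * transpose_mat Y)"
  have W: "W \<in> carrier_mat n n" using LL Y by (auto simp: W_def)
  have tX: "transpose_mat X \<in> carrier_mat n n" and tY: "transpose_mat Y \<in> carrier_mat n n"
    and tL: "transpose_mat LL \<in> carrier_mat n n" and tW: "transpose_mat W \<in> carrier_mat n n"
    using X Y LL W by auto
  have "transpose_mat LL * W = ?S * (Y * transpose_mat Y)"
    unfolding W_def gram[symmetric] using LL tL Y tY by (simp add: assoc)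
  also have "\<dots> = transpose_mat X * ((X * Y) * transpose_mat Y)"
    using X tX Y tY by (simp add: assoc)
  also have "\<dots> = transpose_mat (Y * X)"
    using transpose_mult[OF Y X, symmetric] tY by (simp add: XY)
  finally have "transpose_mat LL * W = 1\<^sub>m n" by (simp add: YX)
  then have "transpose_mat (transpose_mat LL * W) = 1\<^sub>m n" by simp
  then have WL: "transpose_mat W * LL = 1\<^sub>m n" using transpose_mult[OF tL W] by simp
  have LW: "LL * transpose_mat W = 1\<^sub>m n" by (rule mat_mult_left_right_inverse[OF tW LL WL])
  define Q where "Q = X * transpose_mat W"
  have Q: "Q \<in> carrier_mat n n" using X tW by (auto simp: Q_def)
  have tQ: "transpose_mat Q = W * transpose_mat X"
    using transpose_mult[OF X tW] by (simp add: Q_def)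
  have "transpose_mat Q * Q = W * (?S * transpose_mat W)"
    unfolding tQ unfolding Q_def using W X tX tW by (simp add: assoc)
  also have "\<dots> = W * (transpose_mat LL * (LL * transpose_mat W))"
    unfolding gram[symmetric] using LL tL tW by (simp add: assoc)
  also have "\<dots> = transpose_mat (LL * transpose_mat W)"
    using transpose_mult[OF LL tW, symmetric] tL by (simp add: LW)
  finally have QQ: "transpose_mat Q * Q = 1\<^sub>m n" by (simp add: LW)
  have QQ': "Q * transpose_mat Q = 1\<^sub>m n"
    by (rule mat_mult_left_right_inverse[OF _ Q QQ]) (use Q in auto)
  have "X = Q * LL" unfolding Q_def using X tW LL WL by (simp add: assoc)
  then have "is_QL n X (Q, LL)"
    unfolding is_QL_def using Q LL QQ QQ' L(1,2) by (auto simp: LL_def)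
  then show ?thesis by blast
qed

text \<open>The orthogonal factor cancels, so L is a Cholesky factor of the Gram matrix of
  \<open>X\<close>; this reduces uniqueness of L to \<open>cholesky_unique\<close>.\<close>

lemma is_QL_gram:
  assumes "is_QL n X (Q, L)"
  shows "transpose_mat X * X = transpose_mat L * L"
proof -
  note assoc = assoc_mult_mat[of _ n n _ n _ n]
  have Q: "Q \<in> carrier_mat n n" and L: "L \<in> carrier_mat n n"
    and QQ: "transpose_mat Q * Q = 1\<^sub>m n" and X: "X = Q * L"
    using assms by (auto simp: is_QL_def)
  have tQ: "transpose_mat Q \<in> carrier_mat n n" and tL: "transpose_mat L \<in> carrier_mat n n"
    using Q L by auto
  have "transpose_mat X * X = transpose_mat L * ((transpose_mat Q * Q) * L)"
    unfolding X transpose_mult[OF Q L] using Q L tQ tL by (simp add: assoc)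
  then show ?thesis using L by (simp add: QQ)
qed

text \<open>Both lower factors are Cholesky factors of the same Gram matrix, hence equal. The common
  L has the inverse \<open>Y * Q\<close>, because Y Q L = Y X = 1, and can be cancelled from Q L =
  Q' L.\<close>

lemma is_QL_unique:
  assumes X: "X \<in> carrier_mat n n" and Y: "Y \<in> carrier_mat n n" and YX: "Y * X = 1\<^sub>m n"
    and d: "is_QL n X d" and d': "is_QL n X d'"
  shows "d = d'"
proof -
  note assoc = assoc_mult_mat[of _ n n _ n _ n]
  obtain Q L Q' L' where eqs: "d = (Q, L)" "d' = (Q', L')" by fastforce
  have Q: "Q \<in> carrier_mat n n" and L: "L \<in> carrier_mat n n" and XQ: "X = Q * L"
    and Q': "Q' \<in> carrier_mat n n" and L': "L' \<in> carrier_mat n n" and XQ': "X = Q' * L'"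
    and tri: "\<And>a b. a < b \<Longrightarrow> b < n \<Longrightarrow> L $$ (a, b) = 0" "\<And>a. a < n \<Longrightarrow> L $$ (a, a) > 0"
    and tri': "\<And>a b. a < b \<Longrightarrow> b < n \<Longrightarrow> L' $$ (a, b) = 0" "\<And>a. a < n \<Longrightarrow> L' $$ (a, a) > 0"
    using d d' unfolding eqs is_QL_def by auto
  have gram: "transpose_mat L * L = transpose_mat L' * L'"
    using is_QL_gram[OF d[unfolded eqs]] is_QL_gram[OF d'[unfolded eqs]] by simp
  have sums: "(\<Sum>k<n. L $$ (k, i) * L $$ (k, j)) = (\<Sum>k<n. L' $$ (k, i) * L' $$ (k, j))"
    if "i < n" "j < n" for i j
    using transpose_mult_self_index[OF L that] transpose_mult_self_index[OF L' that] gram by simp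
  have LL': "L = L'"
    by (rule eq_matI)
      (use L L' cholesky_unique[of n "\<lambda>i j. L $$ (i, j)" "\<lambda>i j. L' $$ (i, j)", OF tri tri' sums] in auto)
  have YQ: "Y * Q \<in> carrier_mat n n" using Y Q by auto
  have "(Y * Q) * L = 1\<^sub>m n" using YX Y Q L by (simp add: XQ assoc)
  then have inv: "L * (Y * Q) = 1\<^sub>m n" by (rule mat_mult_left_right_inverse[OF YQ L])
  have "Q = Q * (L * (Y * Q))" using Q by (simp add: inv)
  also have "\<dots> = X * (Y * Q)" unfolding XQ using Q L YQ by (simp add: assoc)
  also have "\<dots> = Q' * (L * (Y * Q))" unfolding XQ' LL'[symmetric] using Q' L YQ by (simp add: assoc)
  also have "\<dots> = Q'" using Q' by (simp add: inv)
  finally show ?thesis using LL' eqs by simp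
qed

text \<open>\<open>Q_mat\<close> and \<open>L_mat\<close> are components of a definite description;
  by uniqueness, exhibiting any one decomposition evaluates them.\<close>

lemma QL_mat_eqI:
  assumes "A_star T A 0 \<in> carrier_mat K K" "Y \<in> carrier_mat K K" "Y * A_star T A 0 = 1\<^sub>m K"
    and QL: "is_QL K (A_star T A 0) (Q, L)"
  shows "Q_mat K T A = Q" "L_mat K T A = L"
proof -
  have "(THE d. is_QL K (A_star T A 0) d) = (Q, L)"
    by (rule the_equality) (fact QL, rule is_QL_unique[OF assms(1-3) _ QL])
  then show "Q_mat K T A = Q" "L_mat K T A = L" by (simp_all add: Q_mat_def L_mat_def)
qed

text \<open>A product of orthogonal matrices is orthogonal, so a rotation of the shocks only changes
  the orthogonal factor. Models that differ by such a rotation therefore share L, and with it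
  \<open>D_mat\<close>.\<close>

lemma is_QL_orthogonal_mult:
  assumes R: "R \<in> carrier_mat n n" and RR: "transpose_mat R * R = 1\<^sub>m n"
    and "is_QL n X (Q, L)"
  shows "is_QL n (R * X) (R * Q, L)"
proof -
  note assoc = assoc_mult_mat[of _ n n _ n _ n]
  have Q: "Q \<in> carrier_mat n n" and L: "L \<in> carrier_mat n n"
    and QQ: "transpose_mat Q * Q = 1\<^sub>m n" and X: "X = Q * L"
    using assms by (auto simp: is_QL_def)
  have RQ: "R * Q \<in> carrier_mat n n" and tR: "transpose_mat R \<in> carrier_mat n n"
    and tQ: "transpose_mat Q \<in> carrier_mat n n"
    and tRQ: "transpose_mat (R * Q) \<in> carrier_mat n n" using R Q by auto
  have "transpose_mat (R * Q) * (R * Q) = transpose_mat Q * ((transpose_mat R * R) * Q)"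
    unfolding transpose_mult[OF R Q] using R Q tR tQ RQ by (simp add: assoc)
  then have *: "transpose_mat (R * Q) * (R * Q) = 1\<^sub>m n" using Q by (simp add: RR QQ)
  have "(R * Q) * transpose_mat (R * Q) = 1\<^sub>m n"
    by (rule mat_mult_left_right_inverse[OF tRQ RQ *])
  moreover have "R * X = R * Q * L" unfolding X using R Q L by (simp add: assoc)
  ultimately show ?thesis using assms(3) * RQ by (auto simp: is_QL_def)
qed

section \<open>The matrices of the systems form\<close>

lemma permutation_matrix_orthogonal:
  assumes "permutation_matrix K T"
  shows "T \<in> carrier_mat K K" "T * transpose_mat T = 1\<^sub>m K"
proof -
  obtain p where p: "p permutes {..<K}"
    and T: "T = Matrix.mat K K (\<lambda>(i, j). if p i = j then 1 else 0)"
    using assms by (auto simp: permutation_matrix_def)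
  show "T \<in> carrier_mat K K" by (simp add: T)
  show "T * transpose_mat T = 1\<^sub>m K"
  proof (rule eq_matI)
    fix i j assume "i < dim_row (1\<^sub>m K :: real mat)" "j < dim_col (1\<^sub>m K :: real mat)"
    then have ij: "i < K" "j < K" by auto
    have "(T * transpose_mat T) $$ (i, j)
        = (\<Sum>k<K. (if p i = k then 1 else 0) * (if p j = k then 1 else 0))"
      using ij by (simp add: T scalar_prod_def atLeast0LessThan)
    also have "\<dots> = (\<Sum>k<K. if p i = k then (if p i = p j then 1 else 0) else 0)"
      by (intro sum.cong) auto
    also have "\<dots> = (if p i = p j then 1 else 0)"
      using permutes_in_image[OF p, of i] ij by simp
    also have "\<dots> = 1\<^sub>m K $$ (i, j)"
      using permutes_inj[OF p] ij by (auto dest: injD)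
    finally show "(T * transpose_mat T) $$ (i, j) = 1\<^sub>m K $$ (i, j)" .
  qed (auto simp: T)
qed

lemma A_star_inverse:
  assumes A0: "A 0 \<in> carrier_mat K K" "invertible_mat (A 0)" and T: "permutation_matrix K T"
  obtains Y where "Y \<in> carrier_mat K K" "A_star T A 0 \<in> carrier_mat K K"
    "A_star T A 0 * Y = 1\<^sub>m K" "Y * A_star T A 0 = 1\<^sub>m K"
proof -
  note assoc = assoc_mult_mat[of _ K K _ K _ K]
  note T' = permutation_matrix_orthogonal[OF T]
  obtain Z where Z: "Z \<in> carrier_mat K K" "A 0 * Z = 1\<^sub>m K" "Z * A 0 = 1\<^sub>m K"
    using invertible_mat_inverse[OF A0] .
  have tT: "transpose_mat T \<in> carrier_mat K K" using T' by auto
  have X: "A_star T A 0 \<in> carrier_mat K K" using A0 tT by (auto simp: A_star_def)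
  have Y: "T * Z \<in> carrier_mat K K" using T' Z by auto
  have "(T * Z) * A_star T A 0 = T * ((Z * A 0) * transpose_mat T)"
    unfolding A_star_def using T' tT Z(1) A0 by (simp add: assoc)
  also have "\<dots> = 1\<^sub>m K" using T' tT Z by simp
  finally have YX: "(T * Z) * A_star T A 0 = 1\<^sub>m K" .
  from mat_mult_left_right_inverse[OF Y X YX] show ?thesis using that X Y YX by blast
qed

section \<open>Triangularity of \<open>B\<close> and recovery of the columns of
  \<open>\<Omega>\<close> from those of \<open>\<Phi>\<close>\<close>

lemma D_mat_eq:
  assumes "\<And>k. k < K \<Longrightarrow> L_mat K T A $$ (k, k) \<noteq> 0"
  shows "D_mat K T A = mat_diag K (\<lambda>k. 1 / L_mat K T A $$ (k, k))"
  unfolding D_mat_def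
proof (rule minv_eqI)
  show "mat_diag K (\<lambda>k. L_mat K T A $$ (k, k)) * mat_diag K (\<lambda>k. 1 / L_mat K T A $$ (k, k)) = 1\<^sub>m K"
    using assms unfolding mat_diag_diag by (auto simp: mat_diag_def)
qed auto

text \<open>Blocks above the block diagonal vanish by definition. On the block diagonal,
  \<open>D\<close> scales the diagonal of L to one, and the identity in I - D L removes it.\<close>

lemma B_mat_strictly_lower:
  assumes L: "L_mat K T A \<in> carrier_mat K K"
    and tri: "\<And>a b. a < b \<Longrightarrow> b < K \<Longrightarrow> L_mat K T A $$ (a, b) = 0"
    and pos: "\<And>a. a < K \<Longrightarrow> L_mat K T A $$ (a, a) > 0"
    and rc: "r \<le> c" "c < (h + 1) * K"
  shows "B_mat K h T A $$ (r, c) = 0"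
proof -
  let ?L = "L_mat K T A"
  have K: "K > 0" using rc by (cases K) auto
  have "D_mat K T A = mat_diag K (\<lambda>k. 1 / ?L $$ (k, k))"
    by (rule D_mat_eq) (use pos in force)
  then have DL: "D_mat K T A * ?L = Matrix.mat K K (\<lambda>(i, j). 1 / ?L $$ (i, i) * ?L $$ (i, j))"
    using mat_diag_mult_left[OF L] by simp
  have diag: "(1\<^sub>m K - D_mat K T A * ?L) $$ (a, b) = 0" if "a \<le> b" "b < K" for a b
    using that tri[of a b] pos[of a] by (cases "a = b") (auto simp: DL)
  have le: "r div K \<le> c div K" using rc by (simp add: div_le_mono)
  have mods: "r mod K < K" "c mod K < K" using K by auto
  \<comment> \<open>Inside one diagonal block, the order of stacked indices is the order of
    positions in the block.\<close>
  have "r mod K \<le> c mod K" if "r div K = c div K"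
    using rc(1) div_mult_mod_eq[of r K] div_mult_mod_eq[of c K] that by (metis add_le_cancel_left)
  then have "B_block K T A (r div K) (c div K) $$ (r mod K, c mod K) = 0"
    using le diag mods by (auto simp: B_block_def)
  then show ?thesis using rc by (simp add: B_mat_def block_matrix_def)
qed

text \<open>This inverts the definition of \<open>\<Phi>_mat\<close>. Matrix multiplication from the
  left acts on each column separately, so a single column of \<open>\<Phi>\<close> suffices for the
  same column of \<open>\<Omega>\<close>.\<close>

lemma \<Omega>_col_eq:
  assumes A0: "A 0 \<in> carrier_mat K K" "invertible_mat (A 0)" and T: "permutation_matrix K T"
    and i: "i < (h + 1) * K"
  shows "col (\<Omega>_mat K h T A \<Psi>) i
    = (1\<^sub>m ((h + 1) * K) - B_mat K h T A) *\<^sub>v col (\<Phi>_mat K h T A \<Psi>) i"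
proof -
  let ?N = "(h + 1) * K" let ?B = "B_mat K h T A" let ?C = "1\<^sub>m ?N - ?B"
  obtain Y where Y: "Y \<in> carrier_mat K K" "A_star T A 0 \<in> carrier_mat K K"
    "A_star T A 0 * Y = 1\<^sub>m K" "Y * A_star T A 0 = 1\<^sub>m K" using A_star_inverse[of A, OF A0 T] .
  obtain Q L where QL: "is_QL K (A_star T A 0) (Q, L)" using is_QL_exists[OF Y(2,1,3)] by auto
  have LL: "L_mat K T A = L" by (rule QL_mat_eqI[OF Y(2,1,4) QL])
  have zero: "?B $$ (r, c) = 0" if "r \<le> c" "c < ?N" for r c
    by (rule B_mat_strictly_lower) (use QL that in \<open>auto simp: LL is_QL_def\<close>)
  have B: "?B \<in> carrier_mat ?N ?N" and \<Omega>: "\<Omega>_mat K h T A \<Psi> \<in> carrier_mat ?N ?N"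
    by (simp_all add: B_mat_def \<Omega>_mat_def block_matrix_def)
  have C: "?C \<in> carrier_mat ?N ?N" using B by auto
  \<comment> \<open>The matrix 1 - B is unit lower triangular, so its determinant is one and
    \<open>minv\<close> yields a genuine inverse.\<close>
  have "Determinant.det ?C = prod_list (diag_mat ?C)"
    by (rule det_lower_triangular[OF _ C]) (use zero B in auto)
  also have "\<dots> = (\<Prod>k = 0..<?N. ?C $$ (k, k))" using C B by (simp add: prod_list_diag_prod)
  also have "\<dots> = 1" by (rule prod.neutral) (use zero B in auto)
  finally have "?C \<in> Units (ring_mat TYPE(real) ?N ())"
    using det_non_zero_imp_unit[OF C] by simp
  then obtain Z where Z: "Z \<in> carrier_mat ?N ?N" "?C * Z = 1\<^sub>m ?N"
    by (auto simp: Units_def ring_mat_def)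
  have "\<Phi>_mat K h T A \<Psi> = Z * \<Omega>_mat K h T A \<Psi>"
    using minv_eqI[OF C Z] by (simp add: \<Phi>_mat_def)
  then have "col (\<Phi>_mat K h T A \<Psi>) i = Z *\<^sub>v col (\<Omega>_mat K h T A \<Psi>) i"
    using col_mult2[OF Z(1) \<Omega> i] by simp
  moreover have "col (\<Omega>_mat K h T A \<Psi>) i \<in> carrier_vec ?N"
    using carrier_matD(1)[OF \<Omega>] by (intro carrier_vecI) simp
  ultimately show ?thesis using assoc_mult_mat_vec[OF C Z(1)] Z(2) by simp
qed

text \<open>The rotation is R = Y X^{-1}: replacing X^{-1} X^{-T} by Y^{-1} Y^{-T} in R R^T
  collapses the product to the identity. The last clause converts an equality of reduced-form
  coefficients into a relation between structural ones, with the same R for every lag.\<close>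

lemma same_covariance_imp_orthogonal:
  assumes X: "X \<in> carrier_mat n n" "invertible_mat X" and Y: "Y \<in> carrier_mat n n" "invertible_mat Y"
    and eq: "minv X * transpose_mat (minv X) = minv Y * transpose_mat (minv Y)"
  obtains R where "R \<in> carrier_mat n n" "transpose_mat R * R = 1\<^sub>m n"
    "\<And>Z W. \<lbrakk>Z \<in> carrier_mat n n; W \<in> carrier_mat n n; minv X * Z = minv Y * W\<rbrakk> \<Longrightarrow> W = R * Z"
proof -
  note assoc = assoc_mult_mat[of _ n n _ n _ n]
  obtain X' where X': "X' \<in> carrier_mat n n" "X * X' = 1\<^sub>m n" "X' * X = 1\<^sub>m n"
    using invertible_mat_inverse[OF X] .
  obtain Y' where Y': "Y' \<in> carrier_mat n n" "Y * Y' = 1\<^sub>m n" "Y' * Y = 1\<^sub>m n"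
    using invertible_mat_inverse[OF Y] .
  have inv: "minv X = X'" "minv Y = Y'"
    using minv_eqI[OF X(1) X'(1,2)] minv_eqI[OF Y(1) Y'(1,2)] by auto
  define R where "R = Y * X'"
  have R: "R \<in> carrier_mat n n" using Y X' by (auto simp: R_def)
  have t: "transpose_mat X' \<in> carrier_mat n n" "transpose_mat Y' \<in> carrier_mat n n"
    "transpose_mat Y \<in> carrier_mat n n" "transpose_mat R \<in> carrier_mat n n" using X' Y' Y R by auto
  have "R * transpose_mat R = Y * ((X' * transpose_mat X') * transpose_mat Y)"
    unfolding R_def transpose_mult[OF Y(1) X'(1)] using Y X' t by (simp add: assoc)
  also have "\<dots> = Y * ((Y' * transpose_mat Y') * transpose_mat Y)"
    using eq by (simp only: inv)
  also have "\<dots> = (Y * Y') * (transpose_mat Y' * transpose_mat Y)"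
    using Y(1) Y'(1) t by (simp add: assoc)
  also have "\<dots> = transpose_mat (Y * Y')"
    using transpose_mult[OF Y(1) Y'(1), symmetric] t by (simp add: Y'(2))
  finally have "R * transpose_mat R = 1\<^sub>m n" by (simp add: Y'(2))
  then have "transpose_mat R * R = 1\<^sub>m n"
    by (rule mat_mult_left_right_inverse[OF R t(4)])
  moreover have "W = R * Z"
    if Z: "Z \<in> carrier_mat n n" and W: "W \<in> carrier_mat n n" and *: "minv X * Z = minv Y * W" for Z W
  proof -
    have "R * Z = Y * (Y' * W)" unfolding R_def using Y X' Z * by (simp add: assoc inv)
    also have "\<dots> = (Y * Y') * W" using Y(1) Y'(1) W by (simp add: assoc)
    finally show ?thesis using W by (simp add: Y'(2))
  qed
  ultimately show ?thesis using that R by blast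
qed

text \<open>\<open>B\<close> depends on the coefficients only through D, L and the products Q^T
  \<open>A_star T A k\<close>, each of which is invariant when all coefficients are multiplied on
  the left by one orthogonal matrix.\<close>

lemma B_mat_cong:
  assumes A: "\<And>k. A k \<in> carrier_mat K K" "invertible_mat (A 0)"
    and A': "\<And>k. A' k \<in> carrier_mat K K" "invertible_mat (A' 0)"
    and T: "permutation_matrix K T" and srf: "same_reduced_form A \<Psi> A' \<Psi>'"
  shows "B_mat K h T A = B_mat K h T A'"
proof -
  note assoc = assoc_mult_mat[of _ K K _ K _ K]
  obtain R where R: "R \<in> carrier_mat K K" "transpose_mat R * R = 1\<^sub>m K"
    and RA: "\<And>Z W. \<lbrakk>Z \<in> carrier_mat K K; W \<in> carrier_mat K K; minv (A 0) * Z = minv (A' 0) * W\<rbrakk>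
      \<Longrightarrow> W = R * Z"
    using same_covariance_imp_orthogonal[OF A A'] srf unfolding same_reduced_form_def by blast
  have "minv X * X = 1\<^sub>m K" if "X \<in> carrier_mat K K" "invertible_mat X" for X
    using invertible_mat_inverse[OF that] minv_eqI[OF that(1)] by metis
  \<comment> \<open>\<open>same_reduced_form\<close> constrains the lags from 1 on; at lag 0 both
    products are the identity, so the contemporaneous matrices obey the same relation.\<close>
  then have "minv (A 0) * A 0 = minv (A' 0) * A' 0" using A A' by simp
  then have RA: "A' k = R * A k" for k
    using RA[OF A(1) A'(1)] srf by (cases k) (auto simp: same_reduced_form_def)
  have tT: "transpose_mat T \<in> carrier_mat K K"
    using permutation_matrix_orthogonal[OF T] by auto
  have As: "A_star T A k \<in> carrier_mat K K" for k
    unfolding A_star_def by (rule mult_carrier_mat[OF A(1) tT])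
  have RAs: "A_star T A' k = R * A_star T A k" for k
    unfolding A_star_def RA using R A tT by (simp add: assoc)
  obtain Y where Y: "Y \<in> carrier_mat K K" "A_star T A 0 \<in> carrier_mat K K"
    "A_star T A 0 * Y = 1\<^sub>m K" "Y * A_star T A 0 = 1\<^sub>m K" using A_star_inverse[of A, OF A T] .
  obtain Y' where Y': "Y' \<in> carrier_mat K K" "A_star T A' 0 \<in> carrier_mat K K"
    "A_star T A' 0 * Y' = 1\<^sub>m K" "Y' * A_star T A' 0 = 1\<^sub>m K" using A_star_inverse[of A', OF A' T] .
  obtain Q L where QL: "is_QL K (A_star T A 0) (Q, L)" using is_QL_exists[OF Y(2,1,3)] by auto
  have QL': "is_QL K (A_star T A' 0) (R * Q, L)"
    unfolding RAs by (rule is_QL_orthogonal_mult[OF R QL])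
  note eqs = QL_mat_eqI[OF Y(2,1,4) QL] QL_mat_eqI[OF Y'(2,1,4) QL']
  have Q: "Q \<in> carrier_mat K K" using QL by (simp add: is_QL_def)
  have t: "transpose_mat R \<in> carrier_mat K K" "transpose_mat Q \<in> carrier_mat K K" using R Q by auto
  have D: "D_mat K T A' = D_mat K T A" by (simp add: D_mat_def eqs)
  have Dc: "D_mat K T A \<in> carrier_mat K K"
    using QL by (subst D_mat_eq) (auto simp: eqs is_QL_def dest: spec)
  \<comment> \<open>The rotation enters once transposed through Q and once through the coefficient,
    and R^T R cancels.\<close>
  have "transpose_mat (R * Q) * A_star T A' k = transpose_mat Q * A_star T A k" for k
  proof -
    have "transpose_mat (R * Q) * A_star T A' k
        = transpose_mat Q * ((transpose_mat R * R) * A_star T A k)"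
      unfolding RAs transpose_mult[OF R(1) Q] using R(1) Q t As by (simp add: assoc)
    then show ?thesis by (simp only: R(2) left_mult_one_mat[OF As])
  qed
  moreover have "A_star T A' k \<in> carrier_mat K K" "transpose_mat (R * Q) \<in> carrier_mat K K" for k
    using RAs R Q As by auto
  ultimately have "D_mat K T A * transpose_mat (R * Q) * A_star T A' k
      = D_mat K T A * transpose_mat Q * A_star T A k" for k
    using Dc t As by (simp add: assoc)
  then have "B_block K T A a b = B_block K T A' a b" for a b
    by (simp add: B_block_def D eqs)
  then have "B_block K T A = B_block K T A'" by blast
  then show ?thesis by (simp add: B_mat_def)
qed

section \<open>Paths out of a shock\<close>

text \<open>A weak form of consecutiveness that speaks of membership instead of positions. It is
  enough to exclude arcs that leave a vertex which is not the start and which no arc enters.\<close>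

lemma pcas_tail_cases:
  assumes "pcas u p v" "e \<in> set p"
  shows "fst e = u \<or> (\<exists>e'\<in>set p. fst e = snd e')"
  using assms by (induction p arbitrary: u) auto

text \<open>Every arc of the graph ends in a \<open>Var\<close>, so a shock can be the tail of an
  arc on the path only if it is the starting vertex. Hence only column \<open>i\<close> of
  \<open>\<Omega>\<close> is visible along the path.\<close>

lemma path_arc_cases:
  assumes "p \<in> paths K h B \<Omega> (Shock i) v" "e \<in> set p"
  obtains m n where "e = (Var m, Var n)" "m < (h + 1) * K" "n < (h + 1) * K" "B $$ (n, m) \<noteq> 0"
  | n where "e = (Shock i, Var n)" "i < K" "n < (h + 1) * K" "\<Omega> $$ (n, i) \<noteq> 0"
proof -
  have cas: "pcas (Shock i) p v" and arcs: "set p \<subseteq> parcs (system_graph K h B \<Omega>)"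
    using assms(1) by (auto simp: paths_def pre_digraph.apath_def pre_digraph.awalk_def
        cas_with_proj_eq)
  have "fst e = Shock i \<or> (\<exists>e'\<in>set p. fst e = snd e')"
    by (rule pcas_tail_cases[OF cas assms(2)])
  moreover have "\<exists>n. snd e' = Var n" if "e' \<in> set p" for e'
    using subsetD[OF arcs that] by (auto simp: system_graph_def)
  ultimately have tail: "fst e = Shock i \<or> (\<exists>m. fst e = Var m)" by metis
  have "e \<in> parcs (system_graph K h B \<Omega>)" using arcs assms(2) by blast
  then consider m n where "e = (Var m, Var n)" "m < (h + 1) * K" "n < (h + 1) * K" "B $$ (n, m) \<noteq> 0"
    | k n where "e = (Shock k, Var n)" "k < K" "n < (h + 1) * K" "\<Omega> $$ (n, k) \<noteq> 0"
    unfolding system_graph_def by auto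
  then show ?thesis using tail that by cases auto
qed

text \<open>Each arc of the path has a coefficient from \<open>B\<close> or from the shared column,
  so it is also an arc of the other graph. The vertex set, the chaining of arcs and the distinctness
  of visited vertices do not depend on \<open>\<Omega>\<close>. The hypothesis is symmetric, so
  equality follows by applying the lemma twice.\<close>

lemma paths_subset:
  assumes "\<And>n. n < (h + 1) * K \<Longrightarrow> \<Omega> $$ (n, i) = \<Omega>' $$ (n, i)"
  shows "paths K h B \<Omega> (Shock i) v \<subseteq> paths K h B \<Omega>' (Shock i) v"
proof
  fix p assume p: "p \<in> paths K h B \<Omega> (Shock i) v"
  have "set p \<subseteq> parcs (system_graph K h B \<Omega>')"
  proof
    fix e assume "e \<in> set p"
    with p show "e \<in> parcs (system_graph K h B \<Omega>')"
      by (rule path_arc_cases) (use assms in \<open>auto simp: system_graph_def\<close>)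
  qed
  then show "p \<in> paths K h B \<Omega>' (Shock i) v"
    using p by (simp add: paths_def pre_digraph.apath_def pre_digraph.awalk_def
        cas_with_proj_eq awalk_verts_with_proj_eq)
      (simp add: system_graph_def)
qed

text \<open>Holds term by term: along these paths \<open>path_coeff\<close> reads only
  \<open>B\<close> and the shared column.\<close>

lemma transmission_effect_cong:
  assumes "\<And>n. n < (h + 1) * K \<Longrightarrow> \<Omega> $$ (n, i) = \<Omega>' $$ (n, i)"
    and P: "P \<subseteq> paths K h B \<Omega> (Shock i) v"
  shows "transmission_effect B \<Omega> \<xi> P = transmission_effect B \<Omega>' \<xi> P"
proof -
  have "path_coeff B \<Omega> e = path_coeff B \<Omega>' e" if "p \<in> P" "e \<in> set p" for p e
    using subsetD[OF P that(1)] that(2) by (rule path_arc_cases) (use assms(1) in auto)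
  then have "map (path_coeff B \<Omega>) p = map (path_coeff B \<Omega>') p" if "p \<in> P" for p
    using that by simp
  then show ?thesis unfolding transmission_effect_def by (intro sum.cong refl arg_cong2[where f = "(*)"]
      arg_cong[where f = prod_list])
qed

theorem theorem4:
  fixes K h l\<^sub>1 q\<^sub>1 l\<^sub>2 q\<^sub>2 i :: nat
    and T :: "real mat"
    and M\<^sub>1 :: "'w measure" and M\<^sub>2 :: "'v measure"
    and A\<^sub>1 \<Psi>\<^sub>1 A\<^sub>2 \<Psi>\<^sub>2 :: "nat \<Rightarrow> real mat"
    and y\<^sub>1 \<epsilon>\<^sub>1 :: "int \<Rightarrow> 'w \<Rightarrow> real Matrix.vec"
    and y\<^sub>2 \<epsilon>\<^sub>2 :: "int \<Rightarrow> 'v \<Rightarrow> real Matrix.vec"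
  assumes "structural_VARMA M\<^sub>1 K l\<^sub>1 q\<^sub>1 A\<^sub>1 \<Psi>\<^sub>1 y\<^sub>1 \<epsilon>\<^sub>1"
    and "structural_VARMA M\<^sub>2 K l\<^sub>2 q\<^sub>2 A\<^sub>2 \<Psi>\<^sub>2 y\<^sub>2 \<epsilon>\<^sub>2"
    and "permutation_matrix K T"
    and "i < K"
    and "same_reduced_form A\<^sub>1 \<Psi>\<^sub>1 A\<^sub>2 \<Psi>\<^sub>2"
    and "col (\<Phi>_mat K h T A\<^sub>1 \<Psi>\<^sub>1) i = col (\<Phi>_mat K h T A\<^sub>2 \<Psi>\<^sub>2) i"
  shows "\<forall>j < (h + 1) * K.
    paths K h (B_mat K h T A\<^sub>1) (\<Omega>_mat K h T A\<^sub>1 \<Psi>\<^sub>1) (Shock i) (Var j) =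
    paths K h (B_mat K h T A\<^sub>2) (\<Omega>_mat K h T A\<^sub>2 \<Psi>\<^sub>2) (Shock i) (Var j) \<and>
    (\<forall>P \<subseteq> paths K h (B_mat K h T A\<^sub>1) (\<Omega>_mat K h T A\<^sub>1 \<Psi>\<^sub>1) (Shock i) (Var j). \<forall>\<xi>::real.
      transmission_effect (B_mat K h T A\<^sub>1) (\<Omega>_mat K h T A\<^sub>1 \<Psi>\<^sub>1) \<xi> P =
      transmission_effect (B_mat K h T A\<^sub>2) (\<Omega>_mat K h T A\<^sub>2 \<Psi>\<^sub>2) \<xi> P)"
proof -
  interpret S1: structural_VARMA M\<^sub>1 K l\<^sub>1 q\<^sub>1 A\<^sub>1 \<Psi>\<^sub>1 y\<^sub>1 \<epsilon>\<^sub>1 by fact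
  interpret S2: structural_VARMA M\<^sub>2 K l\<^sub>2 q\<^sub>2 A\<^sub>2 \<Psi>\<^sub>2 y\<^sub>2 \<epsilon>\<^sub>2 by fact
  let ?N = "(h + 1) * K"
  have i: "i < ?N" using assms(4) by simp
  have B: "B_mat K h T A\<^sub>1 = B_mat K h T A\<^sub>2"
    by (rule B_mat_cong[OF S1.A_carrier S1.A0_nonsingular S2.A_carrier S2.A0_nonsingular assms(3,5)])
  have "col (\<Omega>_mat K h T A\<^sub>1 \<Psi>\<^sub>1) i = col (\<Omega>_mat K h T A\<^sub>2 \<Psi>\<^sub>2) i"
    using \<Omega>_col_eq[of A\<^sub>1, OF S1.A_carrier S1.A0_nonsingular assms(3) i]
      \<Omega>_col_eq[of A\<^sub>2, OF S2.A_carrier S2.A0_nonsingular assms(3) i] assms(6) B by simp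
  \<comment> \<open>The bound on \<open>n\<close> matters: matrix entries are determined only inside
    the dimensions, and these are exactly the indices that occur in the graph.\<close>
  moreover have "col (\<Omega>_mat K h T A \<Psi>) i $ n = \<Omega>_mat K h T A \<Psi> $$ (n, i)" if "n < ?N" for A \<Psi> n
    using that i by (simp add: \<Omega>_mat_def block_matrix_def)
  ultimately have \<Omega>: "\<Omega>_mat K h T A\<^sub>1 \<Psi>\<^sub>1 $$ (n, i) = \<Omega>_mat K h T A\<^sub>2 \<Psi>\<^sub>2 $$ (n, i)" if "n < ?N" for n
    using that by metis
  have "paths K h (B_mat K h T A\<^sub>2) (\<Omega>_mat K h T A\<^sub>1 \<Psi>\<^sub>1) (Shock i) v =
      paths K h (B_mat K h T A\<^sub>2) (\<Omega>_mat K h T A\<^sub>2 \<Psi>\<^sub>2) (Shock i) v" for v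
    by (intro equalityI paths_subset) (simp_all add: \<Omega>)
  then show ?thesis unfolding B using transmission_effect_cong[OF \<Omega>] by blast
qed

end
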